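(* Let $1<p<\infty$ and let $T\in\mathcal L(\ell_p)$. Then $\overline{W(T)}$ is star-shaped, and every point of $W_e(T)$ is a star-centre of $\overline{W(T)}$.
   Context: $\ell_p=\ell_p(\mathbb N)$ is the complex sequence space and $\mathcal L(\ell_p)$ its algebra of bounded linear operators; the bar denotes closure in $\mathbb C$. With $1/p+1/q=1$, the dual $(\ell_p)^*$ is identified with $\ell_q$ via $\langle x,y\rangle=\sum_j x_j\overline{y_j}$. For $x=(x_j)\in\ell_p$ put $J(x)=(x_j|x_j|^{p-2})_j\in\ell_q$ (with $0$ in the coordinates where $x_j=0$). The numerical range is $W(T)=\{\langle Tx,J(x)\rangle:\ x\in\ell_p,\ \|x\|_p=1\}$. The essential numerical range $W_e(T)$ is the set of all $\lambda\in\mathbb C$ for which there is a net (equivalently, a sequence) of unit vectors $x_\alpha\in\ell_p$ with $x_\alpha\to0$ weakly and $\langle Tx_\alpha,J(x_\alpha)\rangle\to\lambda$. A point $c$ of a set $A\subset\mathbb C$ is a star-centre of $A$ if $(1-t)c+tz\in A$ for all $z\in A$ and $t\in[0,1]$; $A$ is star-shaped if it has a star-centre. *)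

theory Defs
  imports "HOL-Analysis.Analysis"
begin

text \<open>
  The exponent \<open>p\<close> is a real variable, so \<open>\<ell>\<^sub>p\<close> is a carrier set inside
  \<^typ>\<open>nat \<Rightarrow> complex\<close> and not a type. Operators and functionals are total HOL functions of
  which only the values on \<open>ell p\<close> matter.
\<close>

definition ell :: "real \<Rightarrow> (nat \<Rightarrow> complex) set" where
  "ell p = {x. summable (\<lambda>j. norm (x j) powr p)}"

definition ell_norm :: "real \<Rightarrow> (nat \<Rightarrow> complex) \<Rightarrow> real" where
  "ell_norm p x = (\<Sum>j. norm (x j) powr p) powr (1 / p)"

definition bounded_operator :: "real \<Rightarrow> ((nat \<Rightarrow> complex) \<Rightarrow> nat \<Rightarrow> complex) \<Rightarrow> bool" where
  "bounded_operator p T \<longleftrightarrow>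
     (\<forall>x\<in>ell p. T x \<in> ell p) \<and>
     (\<forall>x\<in>ell p. \<forall>y\<in>ell p. T (\<lambda>j. x j + y j) = (\<lambda>j. T x j + T y j)) \<and>
     (\<forall>a. \<forall>x\<in>ell p. T (\<lambda>j. a * x j) = (\<lambda>j. a * T x j)) \<and>
     (\<exists>C. \<forall>x\<in>ell p. ell_norm p (T x) \<le> C * ell_norm p x)"

definition bounded_functional :: "real \<Rightarrow> ((nat \<Rightarrow> complex) \<Rightarrow> complex) \<Rightarrow> bool" where
  "bounded_functional p \<phi> \<longleftrightarrow>
     (\<forall>x\<in>ell p. \<forall>y\<in>ell p. \<phi> (\<lambda>j. x j + y j) = \<phi> x + \<phi> y) \<and>
     (\<forall>a. \<forall>x\<in>ell p. \<phi> (\<lambda>j. a * x j) = a * \<phi> x) \<and>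
     (\<exists>C. \<forall>x\<in>ell p. norm (\<phi> x) \<le> C * ell_norm p x)"

definition weakly_null :: "real \<Rightarrow> (nat \<Rightarrow> nat \<Rightarrow> complex) \<Rightarrow> bool" where
  "weakly_null p xs \<longleftrightarrow> (\<forall>\<phi>. bounded_functional p \<phi> \<longrightarrow> (\<lambda>n. \<phi> (xs n)) \<longlonglongrightarrow> 0)"

definition pairing :: "(nat \<Rightarrow> complex) \<Rightarrow> (nat \<Rightarrow> complex) \<Rightarrow> complex" where
  "pairing x y = (\<Sum>j. x j * cnj (y j))"

text \<open>Where \<open>x j = 0\<close> the first factor makes the coordinate \<open>0\<close>, also for \<open>p < 2\<close>.\<close>

definition duality_map :: "real \<Rightarrow> (nat \<Rightarrow> complex) \<Rightarrow> nat \<Rightarrow> complex" where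
  "duality_map p x = (\<lambda>j. x j * of_real (norm (x j) powr (p - 2)))"

definition numerical_range ::
    "real \<Rightarrow> ((nat \<Rightarrow> complex) \<Rightarrow> nat \<Rightarrow> complex) \<Rightarrow> complex set" where
  "numerical_range p T =
     {pairing (T x) (duality_map p x) | x. x \<in> ell p \<and> ell_norm p x = 1}"

definition essential_numerical_range ::
    "real \<Rightarrow> ((nat \<Rightarrow> complex) \<Rightarrow> nat \<Rightarrow> complex) \<Rightarrow> complex set" where
  "essential_numerical_range p T =
     {l. \<exists>xs. (\<forall>n. xs n \<in> ell p \<and> ell_norm p (xs n) = 1) \<and> weakly_null p xs \<and>
            (\<lambda>n. pairing (T (xs n)) (duality_map p (xs n))) \<longlonglongrightarrow> l}"

definition star_centre :: "complex set \<Rightarrow> complex \<Rightarrow> bool" where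
  "star_centre A c \<longleftrightarrow>
     c \<in> A \<and> (\<forall>z\<in>A. \<forall>t\<in>{0..1::real}. (1 - t) *\<^sub>R c + t *\<^sub>R z \<in> A)"

lemma star_centre_iff_closed_segment:
  "star_centre A c \<longleftrightarrow> c \<in> A \<and> (\<forall>z\<in>A. closed_segment c z \<subseteq> A)"
  by (fastforce simp: star_centre_def closed_segment_def)

lemma starlike_iff_star_centre: "starlike A \<longleftrightarrow> (\<exists>c. star_centre A c)"
  by (auto simp: starlike_def star_centre_iff_closed_segment)

end

theory Submission
  imports Defs
begin

text \<open>
  Write \<open>w x = \<langle>T x, J x\<rangle>\<close>. This is homogeneous of degree \<open>p\<close> in \<open>\<bar>a\<bar>\<close> under \<open>x \<mapsto> a x\<close>, so that
  \<open>w x / \<parallel>x\<parallel>\<^sup>p\<close> lies in the numerical range for every nonzero \<open>x\<close>. The map \<open>J\<close> is not additive,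
  but it is additive on vectors with disjoint supports, and then \<open>\<parallel>x + y\<parallel>\<^sup>p = \<parallel>x\<parallel>\<^sup>p + \<parallel>y\<parallel>\<^sup>p\<close> too.

  Let \<open>z = w x\<close> with \<open>\<parallel>x\<parallel> = 1\<close>, and let \<open>w (y\<^sub>n) \<longlonglongrightarrow> l\<close> along a weakly null sequence of unit
  vectors. If \<open>x\<close> is supported in \<open>{..<N}\<close> and all \<open>y\<^sub>n\<close> outside it, then with \<open>a\<^sup>p = t\<close> and
  \<open>b\<^sup>p = 1 - t\<close>
  \<open>w (a x + b y\<^sub>n) = t w x + (1 - t) w (y\<^sub>n) + a b\<^bsup>p-1\<^esup> \<langle>T x, J y\<^sub>n\<rangle> + a\<^bsup>p-1\<^esup> b \<langle>T y\<^sub>n, J x\<rangle>\<close>.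
  The last term tends to \<open>0\<close> because \<open>y\<^sub>n\<close> is weakly null and the third because the coordinates
  of \<open>y\<^sub>n\<close> tend to \<open>0\<close>, which gives \<open>t z + (1 - t) l\<close> in the limit
  (\<open>combination_in_closure_numerical_range\<close>).

  The support condition is reached by truncation. Cutting off a part of \<open>x\<close> that is small in norm
  changes \<open>w x\<close> only a little (\<open>form_diff_restrict_to_tendsto_0\<close>): in \<open>y\<^sub>n\<close> the first \<open>N\<close>
  coordinates are small for large \<open>n\<close>, and in \<open>x\<close> the coordinates from \<open>N\<close> on are small for large
  \<open>N\<close>. So \<open>n\<close> tends to infinity first, for fixed \<open>N\<close>, and \<open>N\<close> afterwards; truncation disturbs the
  normalization, hence the division by \<open>\<parallel>x\<parallel>\<^sup>p\<close> throughout
  (\<open>segment_in_closure_numerical_range\<close>).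

  Finally a star-centre exists because the essential numerical range is nonempty: the standard
  unit vectors are weakly null, as \<open>p > 1\<close>, and their values under \<open>w\<close> are bounded, so that a
  subsequence of these converges.
\<close>

section \<open>The sequence space\<close>

lemma ell_norm_nonneg: "0 \<le> ell_norm p x"
  by (simp add: ell_norm_def)

lemma ell_norm_powr:
  assumes "1 < p" "x \<in> ell p"
  shows "ell_norm p x powr p = (\<Sum>j. norm (x j) powr p)"
proof -
  have "0 \<le> (\<Sum>j. norm (x j) powr p)"
    using assms by (intro suminf_nonneg) (auto simp: ell_def)
  then show ?thesis
    using assms by (simp add: ell_norm_def powr_powr)
qed

lemma ell_norm_leI:
  assumes "1 < p" "x \<in> ell p" "0 \<le> c" "(\<Sum>j. norm (x j) powr p) \<le> c powr p"
  shows "ell_norm p x \<le> c"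
proof -
  have "ell_norm p x powr p \<le> c powr p"
    using assms ell_norm_powr by simp
  then show ?thesis
    using assms powr_less_mono2[of p c "ell_norm p x"] by (cases "ell_norm p x \<le> c") auto
qed

lemma norm_coordinate_le_ell_norm:
  assumes "1 < p" "x \<in> ell p"
  shows "norm (x j) \<le> ell_norm p x"
proof -
  have s: "summable (\<lambda>j. norm (x j) powr p)"
    using assms by (simp add: ell_def)
  have "norm (x j) powr p \<le> (\<Sum>j. norm (x j) powr p)"
    using sum_le_suminf[OF s, of "{j}"] by simp
  then have "norm (x j) powr p \<le> ell_norm p x powr p"
    using assms ell_norm_powr by simp
  then show ?thesis
    using assms powr_less_mono2[of p "ell_norm p x" "norm (x j)"]
    by (cases "norm (x j) \<le> ell_norm p x") (auto simp: ell_norm_nonneg)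
qed

text \<open>
  The coarse estimate \<open>\<bar>a + b\<bar>\<^sup>p \<le> (2 max \<bar>a\<bar> \<bar>b\<bar>)\<^sup>p\<close> suffices for summability. Norms of sums are
  only ever taken for disjoint supports, where they are computed exactly.
\<close>

lemma ell_add:
  assumes "1 < p" "x \<in> ell p" "y \<in> ell p"
  shows "(\<lambda>j. x j + y j) \<in> ell p"
proof -
  have s: "summable (\<lambda>j. 2 powr p * (norm (x j) powr p + norm (y j) powr p))"
    using assms by (intro summable_mult summable_add) (auto simp: ell_def)
  have "norm (x j + y j) powr p \<le> 2 powr p * (norm (x j) powr p + norm (y j) powr p)" for j
  proof -
    have "norm (x j + y j) \<le> 2 * max (norm (x j)) (norm (y j))"
      using norm_triangle_ineq[of "x j" "y j"] by linarith
    then have "norm (x j + y j) powr p \<le> (2 * max (norm (x j)) (norm (y j))) powr p"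
      using assms by (intro powr_mono2) auto
    also have "\<dots> = 2 powr p * max (norm (x j)) (norm (y j)) powr p"
      by (simp add: powr_mult)
    also have "\<dots> \<le> 2 powr p * (norm (x j) powr p + norm (y j) powr p)"
      by (intro mult_left_mono) (auto simp: max_def)
    finally show ?thesis .
  qed
  then show ?thesis
    unfolding ell_def mem_Collect_eq by (intro summable_comparison_test'[OF s, of 0]) auto
qed

lemma ell_scale: "x \<in> ell p \<Longrightarrow> (\<lambda>j. a * x j) \<in> ell p"
  by (auto simp: ell_def norm_mult powr_mult intro: summable_mult)

lemma ell_norm_scale:
  assumes "1 < p" "x \<in> ell p"
  shows "ell_norm p (\<lambda>j. a * x j) = norm a * ell_norm p x"
proof -
  have s: "summable (\<lambda>j. norm (x j) powr p)"
    using assms by (simp add: ell_def)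
  have "(\<Sum>j. norm (a * x j) powr p) = norm a powr p * (\<Sum>j. norm (x j) powr p)"
    using suminf_mult[OF s, of "norm a powr p"] by (simp add: norm_mult powr_mult)
  then show ?thesis
    using assms suminf_nonneg[OF s] by (simp add: ell_norm_def powr_mult powr_powr)
qed

lemma ell_norm_powr_add_disjoint:
  assumes p: "1 < p" and xy: "x \<in> ell p" "y \<in> ell p" and dis: "\<And>j. x j = 0 \<or> y j = 0"
  shows "ell_norm p (\<lambda>j. x j + y j) powr p = ell_norm p x powr p + ell_norm p y powr p"
proof -
  have "norm (x j + y j) powr p = norm (x j) powr p + norm (y j) powr p" for j
    using dis[of j] p by auto
  then have "(\<Sum>j. norm (x j + y j) powr p) =
      (\<Sum>j. norm (x j) powr p) + (\<Sum>j. norm (y j) powr p)"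
    using xy by (simp add: suminf_add ell_def)
  then show ?thesis
    using p xy ell_add[OF p xy] by (simp add: ell_norm_powr)
qed

definition restrict_to :: "nat set \<Rightarrow> (nat \<Rightarrow> complex) \<Rightarrow> nat \<Rightarrow> complex" where
  "restrict_to A x = (\<lambda>j. if j \<in> A then x j else 0)"

lemma restrict_to_add_Compl: "(\<lambda>j. restrict_to A x j + restrict_to (- A) x j) = x"
  by (auto simp: restrict_to_def)

lemma restrict_to_disjoint: "restrict_to A x j = 0 \<or> restrict_to (- A) x j = 0"
  by (auto simp: restrict_to_def)

lemma restrict_to_ell:
  assumes "x \<in> ell p"
  shows "restrict_to A x \<in> ell p"
proof -
  have s: "summable (\<lambda>j. norm (x j) powr p)"
    using assms by (simp add: ell_def)
  show ?thesis
    unfolding ell_def mem_Collect_eq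
    by (intro summable_comparison_test'[OF s, of 0]) (auto simp: restrict_to_def)
qed

lemma ell_norm_powr_restrict_to_Compl:
  assumes "1 < p" "x \<in> ell p"
  shows "ell_norm p x powr p =
    ell_norm p (restrict_to A x) powr p + ell_norm p (restrict_to (- A) x) powr p"
  using ell_norm_powr_add_disjoint[of p "restrict_to A x" "restrict_to (- A) x"]
    restrict_to_ell[OF assms(2)] restrict_to_disjoint assms(1)
  by (simp add: restrict_to_add_Compl)

lemma ell_norm_restrict_to_le:
  assumes "1 < p" "x \<in> ell p"
  shows "ell_norm p (restrict_to A x) \<le> ell_norm p x"
  using assms ell_norm_powr_restrict_to_Compl[OF assms, of A] ell_norm_nonneg
  by (intro ell_norm_leI) (auto simp: restrict_to_ell simp flip: ell_norm_powr)

lemma ell_norm_powr_restrict_to_finite: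
  assumes "1 < p" "x \<in> ell p" "finite A"
  shows "ell_norm p (restrict_to A x) powr p = (\<Sum>j\<in>A. norm (x j) powr p)"
proof -
  have "(\<Sum>j. norm (restrict_to A x j) powr p) = (\<Sum>j\<in>A. norm (restrict_to A x j) powr p)"
    using assms by (intro suminf_finite) (auto simp: restrict_to_def)
  then show ?thesis
    using assms by (simp add: ell_norm_powr restrict_to_ell) (simp add: restrict_to_def)
qed

lemma tendsto_0_powr:
  fixes f :: "nat \<Rightarrow> real"
  assumes "f \<longlonglongrightarrow> 0" "0 < a" "\<And>n. 0 \<le> f n"
  shows "(\<lambda>n. f n powr a) \<longlonglongrightarrow> 0"
  by (rule tendsto_zero_powrI[OF assms(1) tendsto_const]) (use assms in auto)

lemma tendsto_0_of_powr:
  fixes f :: "nat \<Rightarrow> real"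
  assumes "1 < p" "\<And>n. 0 \<le> f n" "(\<lambda>n. f n powr p) \<longlonglongrightarrow> 0"
  shows "f \<longlonglongrightarrow> 0"
proof -
  have "(\<lambda>n. (f n powr p) powr (1 / p)) \<longlonglongrightarrow> 0"
    using assms by (intro tendsto_0_powr[OF assms(3)]) auto
  then show ?thesis
    using assms by (simp add: powr_powr)
qed

lemma ell_norm_tail_tendsto_0:
  assumes p: "1 < p" and x: "x \<in> ell p"
  shows "(\<lambda>N. ell_norm p (restrict_to (- {..<N}) x)) \<longlonglongrightarrow> 0"
proof (rule tendsto_0_of_powr[OF p])
  have "ell_norm p (restrict_to (- {..<N}) x) powr p =
      ell_norm p x powr p - (\<Sum>j<N. norm (x j) powr p)" for N
    using ell_norm_powr_restrict_to_Compl[OF p x, of "{..<N}"]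
      ell_norm_powr_restrict_to_finite[OF p x, of "{..<N}"] by simp
  moreover have "(\<lambda>N. \<Sum>j<N. norm (x j) powr p) \<longlonglongrightarrow> ell_norm p x powr p"
    using x summable_LIMSEQ by (simp add: ell_norm_powr[OF p x] ell_def)
  ultimately show "(\<lambda>N. ell_norm p (restrict_to (- {..<N}) x) powr p) \<longlonglongrightarrow> 0"
    by (auto intro: tendsto_eq_intros)
qed (simp add: ell_norm_nonneg)

section \<open>The duality pairing\<close>

lemma norm_pairing_summand:
  "norm (v j * cnj (duality_map p y j)) = norm (v j) * norm (y j) powr (p - 1)"
proof (cases "y j = 0")
  case False
  then have "norm (y j) * norm (y j) powr (p - 2) = norm (y j) powr (p - 1)"
    using powr_add[of "norm (y j)" 1 "p - 2"] by simp
  then show ?thesis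
    by (simp add: duality_map_def norm_mult)
qed (simp add: duality_map_def)

text \<open>
  This takes the place of Young's inequality: the left side is at most \<open>max a b powr p\<close>. The
  sharp constants are lost, but only boundedness of the pairing matters.
\<close>

lemma mult_powr_le_add_powr:
  fixes a b :: real
  assumes "1 < p" "0 \<le> a" "0 \<le> b"
  shows "a * b powr (p - 1) \<le> a powr p + b powr p"
proof -
  have step: "c * d powr (p - 1) \<le> m powr p"
    if "0 \<le> c" "0 \<le> d" "c \<le> m" "d \<le> m" for c d m :: real
  proof (cases "m = 0")
    case True
    then show ?thesis using that by simp
  next
    case False
    have "c * d powr (p - 1) \<le> m * m powr (p - 1)"
      using that assms by (intro mult_mono powr_mono2) auto
    also have "\<dots> = m powr p"
      using False that powr_add[of m 1 "p - 1"] by simp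
    finally show ?thesis .
  qed
  have "a * b powr (p - 1) \<le> max a b powr p"
    using assms by (intro step) auto
  also have "\<dots> \<le> a powr p + b powr p"
    by (auto simp: max_def)
  finally show ?thesis .
qed

lemma pairing_summable:
  assumes "1 < p" "v \<in> ell p" "y \<in> ell p"
  shows "summable (\<lambda>j. norm (v j * cnj (duality_map p y j)))"
proof -
  have s: "summable (\<lambda>j. norm (v j) powr p + norm (y j) powr p)"
    using assms by (intro summable_add) (auto simp: ell_def)
  show ?thesis
    using assms mult_powr_le_add_powr
    by (intro summable_comparison_test'[OF s, of 0]) (auto simp: norm_pairing_summand)
qed

lemma norm_pairing_le_add:
  assumes "1 < p" "v \<in> ell p" "y \<in> ell p"
  shows "norm (pairing v (duality_map p y)) \<le> ell_norm p v powr p + ell_norm p y powr p"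
proof -
  have "norm (pairing v (duality_map p y)) \<le> (\<Sum>j. norm (v j * cnj (duality_map p y j)))"
    unfolding pairing_def using assms by (intro summable_norm pairing_summable)
  also have "\<dots> \<le> (\<Sum>j. norm (v j) powr p + norm (y j) powr p)"
    using assms mult_powr_le_add_powr pairing_summable[OF assms]
    by (intro suminf_le summable_add) (auto simp: ell_def norm_pairing_summand)
  also have "\<dots> = ell_norm p v powr p + ell_norm p y powr p"
    using assms by (simp add: ell_norm_powr suminf_add ell_def)
  finally show ?thesis .
qed

lemma pairing_add_left:
  assumes "1 < p" "v \<in> ell p" "v' \<in> ell p" "y \<in> ell p"
  shows "pairing (\<lambda>j. v j + v' j) (duality_map p y) =
    pairing v (duality_map p y) + pairing v' (duality_map p y)"
  unfolding pairing_def
  using assms pairing_summable[THEN summable_norm_cancel]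
  by (subst suminf_add) (auto simp: algebra_simps)

lemma pairing_scale_left:
  assumes "1 < p" "v \<in> ell p" "y \<in> ell p"
  shows "pairing (\<lambda>j. a * v j) (duality_map p y) = a * pairing v (duality_map p y)"
  unfolding pairing_def
  using suminf_mult[OF pairing_summable[OF assms, THEN summable_norm_cancel], of a]
  by (simp add: mult.assoc)

lemma duality_map_add_disjoint:
  assumes "\<And>j. x j = 0 \<or> y j = 0"
  shows "duality_map p (\<lambda>j. x j + y j) = (\<lambda>j. duality_map p x j + duality_map p y j)"
proof
  fix j
  show "duality_map p (\<lambda>j. x j + y j) j = duality_map p x j + duality_map p y j"
    using assms[of j] by (auto simp: duality_map_def)
qed

lemma pairing_add_right_disjoint:
  assumes "1 < p" "v \<in> ell p" "x \<in> ell p" "y \<in> ell p" "\<And>j. x j = 0 \<or> y j = 0"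
  shows "pairing v (duality_map p (\<lambda>j. x j + y j)) =
    pairing v (duality_map p x) + pairing v (duality_map p y)"
  unfolding pairing_def duality_map_add_disjoint[of x y p, OF assms(5)]
  using assms(1-4) pairing_summable[THEN summable_norm_cancel]
  by (subst suminf_add) (auto simp: algebra_simps)

lemma pairing_scale_right:
  assumes "1 < p" "v \<in> ell p" "y \<in> ell p" "0 \<le> a"
  shows "pairing v (duality_map p (\<lambda>j. of_real a * y j)) =
    of_real (a powr (p - 1)) * pairing v (duality_map p y)"
proof -
  have "a * a powr (p - 2) = a powr (p - 1)"
    using assms powr_add[of a 1 "p - 2"] by (cases "a = 0") auto
  then have "duality_map p (\<lambda>j. of_real a * y j) j = of_real (a powr (p - 1)) * duality_map p y j" for j
    using assms by (simp add: duality_map_def norm_mult powr_mult algebra_simps flip: of_real_mult)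
  then show ?thesis
    unfolding pairing_def
    using suminf_mult[OF pairing_summable[OF assms(1-3), THEN summable_norm_cancel],
        of "of_real (a powr (p - 1))"]
    by (simp add: algebra_simps)
qed

lemma ell_norm_eq_0:
  assumes "1 < p" "x \<in> ell p" "ell_norm p x = 0"
  shows "x = (\<lambda>_. 0)"
  using norm_coordinate_le_ell_norm[OF assms(1,2)] assms(3) by auto

text \<open>
  Hoelder's inequality for \<open>v\<close> and \<open>J y\<close>, up to the factor 2 that the coarse pointwise bound
  costs. It follows by rescaling both vectors to norm 1, since the pairing is homogeneous of
  degree 1 in \<open>v\<close> and of degree \<open>p - 1\<close> in \<open>y\<close>.
\<close>

lemma norm_pairing_le:
  assumes p: "1 < p" and v: "v \<in> ell p" and y: "y \<in> ell p"
  shows "norm (pairing v (duality_map p y)) \<le> 2 * ell_norm p v * ell_norm p y powr (p - 1)"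
proof (cases "ell_norm p v = 0 \<or> ell_norm p y = 0")
  case True
  then have "v = (\<lambda>_. 0) \<or> y = (\<lambda>_. 0)"
    using assms ell_norm_eq_0 by blast
  then show ?thesis
    using ell_norm_nonneg by (auto simp: pairing_def duality_map_def)
next
  case False
  define a b where "a = ell_norm p v" and "b = ell_norm p y"
  have ab: "0 < a" "0 < b"
    using False ell_norm_nonneg[of p v] ell_norm_nonneg[of p y] by (auto simp: a_def b_def)
  define v' y' where "v' = (\<lambda>j. of_real (1 / a) * v j)" and "y' = (\<lambda>j. of_real (1 / b) * y j)"
  have mem: "v' \<in> ell p" "y' \<in> ell p"
    unfolding v'_def y'_def by (intro ell_scale v y)+
  have nrm: "ell_norm p v' = 1" "ell_norm p y' = 1"
    unfolding v'_def y'_def ell_norm_scale[OF p v] ell_norm_scale[OF p y]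
    using ab by (auto simp: a_def b_def norm_divide)
  have eq: "v = (\<lambda>j. of_real a * v' j)" "y = (\<lambda>j. of_real b * y' j)"
    using ab by (auto simp: v'_def y'_def)
  have "pairing v (duality_map p y) = of_real a * pairing v' (duality_map p y)"
    using pairing_scale_left[OF p mem(1) y, of "of_real a"] by (simp flip: eq)
  also have "pairing v' (duality_map p y) =
      of_real (b powr (p - 1)) * pairing v' (duality_map p y')"
    using pairing_scale_right[OF p mem(1) mem(2), of b] ab by (simp flip: eq)
  finally have "norm (pairing v (duality_map p y)) =
      a * (b powr (p - 1) * norm (pairing v' (duality_map p y')))"
    using ab by (simp add: norm_mult)
  also have "\<dots> \<le> a * (b powr (p - 1) * 2)"
    using norm_pairing_le_add[OF p mem] nrm ab by (intro mult_left_mono) auto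
  finally show ?thesis
    by (simp add: a_def b_def mult_ac)
qed

section \<open>Weakly null sequences\<close>

lemma bounded_functional_coordinate:
  assumes "1 < p"
  shows "bounded_functional p (\<lambda>x. x j)"
  unfolding bounded_functional_def
  using norm_coordinate_le_ell_norm[OF assms] by (auto intro!: exI[of _ 1])

lemma weakly_null_coordinate:
  assumes "1 < p" "weakly_null p xs"
  shows "(\<lambda>n. xs n j) \<longlonglongrightarrow> 0"
  using assms bounded_functional_coordinate unfolding weakly_null_def by blast

lemma ell_norm_initial_tendsto_0:
  assumes p: "1 < p" and x: "\<And>n. xs n \<in> ell p" and null: "\<And>j. (\<lambda>n. xs n j) \<longlonglongrightarrow> 0"
  shows "(\<lambda>n. ell_norm p (restrict_to {..<N} (xs n))) \<longlonglongrightarrow> 0"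
proof (rule tendsto_0_of_powr[OF p])
  have "(\<lambda>n. \<Sum>j<N. norm (xs n j) powr p) \<longlonglongrightarrow> 0"
    using p by (intro tendsto_null_sum tendsto_0_powr tendsto_norm_zero null) auto
  then show "(\<lambda>n. ell_norm p (restrict_to {..<N} (xs n)) powr p) \<longlonglongrightarrow> 0"
    using x by (simp add: ell_norm_powr_restrict_to_finite[OF p])
qed (simp add: ell_norm_nonneg)

text \<open>
  A finite block of coordinates of a weakly null sequence tends to 0 even in norm, so removing it
  does not affect weak convergence.
\<close>

lemma weakly_null_tail:
  assumes p: "1 < p" and x: "\<And>n. xs n \<in> ell p" and null: "weakly_null p xs"
  shows "weakly_null p (\<lambda>n. restrict_to (- {..<N}) (xs n))"
  unfolding weakly_null_def
proof (intro allI impI)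
  fix \<phi> assume \<phi>: "bounded_functional p \<phi>"
  let ?P = "\<lambda>n. restrict_to {..<N} (xs n)" and ?Q = "\<lambda>n. restrict_to (- {..<N}) (xs n)"
  obtain C where C: "\<And>x. x \<in> ell p \<Longrightarrow> norm (\<phi> x) \<le> C * ell_norm p x"
    using \<phi> unfolding bounded_functional_def by blast
  have "(\<lambda>n. C * ell_norm p (?P n)) \<longlonglongrightarrow> 0"
    using ell_norm_initial_tendsto_0[where xs = xs and N = N, OF p x weakly_null_coordinate[OF p null]]
    by (intro tendsto_mult_right_zero)
  then have "(\<lambda>n. \<phi> (?P n)) \<longlonglongrightarrow> 0"
    by (rule Lim_null_comparison[rotated]) (auto intro!: always_eventually C restrict_to_ell x)
  moreover have "(\<lambda>n. \<phi> (xs n)) \<longlonglongrightarrow> 0"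
    using null \<phi> unfolding weakly_null_def by blast
  moreover have "\<phi> (xs n) = \<phi> (?P n) + \<phi> (?Q n)" for n
  proof -
    have "\<phi> (\<lambda>j. ?P n j + ?Q n j) = \<phi> (?P n) + \<phi> (?Q n)"
      using \<phi> x restrict_to_ell unfolding bounded_functional_def by blast
    then show ?thesis
      by (simp only: restrict_to_add_Compl)
  qed
  ultimately show "(\<lambda>n. \<phi> (?Q n)) \<longlonglongrightarrow> 0"
    using tendsto_diff[of "\<lambda>n. \<phi> (xs n)" 0 sequentially "\<lambda>n. \<phi> (?P n)" 0] by simp
qed

text \<open>
  On the first \<open>M\<close> coordinates the pairing is a finite sum of null sequences; on the others it is
  small uniformly in \<open>n\<close>, because the tail of \<open>v\<close> has small norm.
\<close>

lemma pairing_tendsto_0: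
  assumes p: "1 < p" and v: "v \<in> ell p" and y: "\<And>n. ys n \<in> ell p"
    and le: "\<And>n. ell_norm p (ys n) \<le> 1" and null: "\<And>j. (\<lambda>n. ys n j) \<longlonglongrightarrow> 0"
  shows "(\<lambda>n. pairing v (duality_map p (ys n))) \<longlonglongrightarrow> 0"
proof (rule LIMSEQ_I)
  fix \<epsilon> :: real assume \<epsilon>: "0 < \<epsilon>"
  obtain M where M: "ell_norm p (restrict_to (- {..<M}) v) < \<epsilon> / 4"
    using LIMSEQ_D[OF ell_norm_tail_tendsto_0[OF p v], of "\<epsilon> / 4"] \<epsilon> ell_norm_nonneg by fastforce
  let ?P = "restrict_to {..<M} v" and ?Q = "restrict_to (- {..<M}) v"
  have P: "pairing ?P (duality_map p (ys n)) = (\<Sum>j<M. v j * cnj (duality_map p (ys n) j))" for n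
  proof -
    have "(\<Sum>j. ?P j * cnj (duality_map p (ys n) j)) =
        (\<Sum>j<M. ?P j * cnj (duality_map p (ys n) j))"
      by (intro suminf_finite) (auto simp: restrict_to_def)
    then show ?thesis
      by (simp add: pairing_def restrict_to_def)
  qed
  have "(\<lambda>n. v j * cnj (duality_map p (ys n) j)) \<longlonglongrightarrow> 0" for j
  proof (rule tendsto_norm_zero_cancel)
    have "(\<lambda>n. norm (ys n j) powr (p - 1)) \<longlonglongrightarrow> 0"
      using p by (intro tendsto_0_powr tendsto_norm_zero null) auto
    then show "(\<lambda>n. norm (v j * cnj (duality_map p (ys n) j))) \<longlonglongrightarrow> 0"
      unfolding norm_pairing_summand by (rule tendsto_mult_right_zero)
  qed
  then have "(\<lambda>n. pairing ?P (duality_map p (ys n))) \<longlonglongrightarrow> 0"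
    unfolding P by (intro tendsto_null_sum)
  then obtain n0 where n0: "\<And>n. n \<ge> n0 \<Longrightarrow> norm (pairing ?P (duality_map p (ys n))) < \<epsilon> / 2"
    using LIMSEQ_D[of _ 0 "\<epsilon> / 2"] \<epsilon> by fastforce
  have "norm (pairing v (duality_map p (ys n)) - 0) < \<epsilon>" if "n \<ge> n0" for n
  proof -
    have "pairing v (duality_map p (ys n)) =
        pairing ?P (duality_map p (ys n)) + pairing ?Q (duality_map p (ys n))"
      using pairing_add_left[OF p restrict_to_ell[OF v] restrict_to_ell[OF v] y, of "{..<M}" "- {..<M}" n]
      by (simp only: restrict_to_add_Compl)
    moreover have "norm (pairing ?Q (duality_map p (ys n))) < \<epsilon> / 2"
    proof -
      have "norm (pairing ?Q (duality_map p (ys n))) \<le>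
          2 * ell_norm p ?Q * ell_norm p (ys n) powr (p - 1)"
        by (intro norm_pairing_le p y restrict_to_ell v)
      also have "\<dots> \<le> 2 * ell_norm p ?Q * 1"
        using le[of n] p by (intro mult_left_mono powr_le1) (auto simp: ell_norm_nonneg)
      finally show ?thesis using M by simp
    qed
    ultimately show ?thesis
      using n0[OF that] norm_triangle_ineq[of "pairing ?P (duality_map p (ys n))"
          "pairing ?Q (duality_map p (ys n))"] by simp
  qed
  then show "\<exists>n0. \<forall>n\<ge>n0. norm (pairing v (duality_map p (ys n)) - 0) < \<epsilon>"
    by blast
qed

definition unit_sequence :: "nat \<Rightarrow> nat \<Rightarrow> complex" where
  "unit_sequence n = restrict_to {n} (\<lambda>_. 1)"

lemma finite_support_ell:
  assumes "finite A"
  shows "restrict_to A x \<in> ell p"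
  unfolding ell_def mem_Collect_eq
  using assms by (intro summable_finite[of A]) (auto simp: restrict_to_def)

lemma ell_norm_finite_support:
  assumes "finite A"
  shows "ell_norm p (restrict_to A x) = (\<Sum>j\<in>A. norm (x j) powr p) powr (1 / p)"
proof -
  have "(\<Sum>j. norm (restrict_to A x j) powr p) = (\<Sum>j\<in>A. norm (restrict_to A x j) powr p)"
    using assms by (intro suminf_finite) (auto simp: restrict_to_def)
  then show ?thesis
    by (simp add: ell_norm_def) (simp add: restrict_to_def)
qed

lemma bounded_functional_finite_support:
  assumes p: "1 < p" and \<phi>: "bounded_functional p \<phi>" and A: "finite A"
  shows "\<phi> (restrict_to A x) = (\<Sum>j\<in>A. x j * \<phi> (unit_sequence j))"
  using A
proof (induction A rule: finite_induct)
  case empty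
  have "\<phi> (\<lambda>j. 0 * unit_sequence 0 j) = 0 * \<phi> (unit_sequence 0)"
    using \<phi> finite_support_ell unfolding bounded_functional_def unit_sequence_def by blast
  then show ?case
    by (simp add: restrict_to_def)
next
  case (insert k A)
  have u: "unit_sequence k \<in> ell p"
    by (simp add: unit_sequence_def finite_support_ell)
  have "restrict_to (insert k A) x = (\<lambda>j. x k * unit_sequence k j + restrict_to A x j)"
    using insert(2) by (auto simp: restrict_to_def unit_sequence_def)
  then have "\<phi> (restrict_to (insert k A) x) = \<phi> (\<lambda>j. x k * unit_sequence k j) + \<phi> (restrict_to A x)"
    using \<phi> ell_scale[OF u, of "x k"] finite_support_ell[OF insert(1)]
    unfolding bounded_functional_def by simp
  also have "\<phi> (\<lambda>j. x k * unit_sequence k j) = x k * \<phi> (unit_sequence k)"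
    using \<phi> u unfolding bounded_functional_def by blast
  finally show ?case
    using insert by simp
qed

text \<open>
  If \<open>\<epsilon> \<le> \<bar>\<phi> e\<^sub>n\<bar>\<close> for all \<open>n\<close> in a set of size \<open>k\<close>, then \<open>\<bar>\<phi>\<bar>\<close> is at least \<open>k \<epsilon>\<close> on the sum of these
  \<open>e\<^sub>n\<close> with suitable unimodular coefficients, a vector of norm \<open>k powr (1 / p)\<close>. As \<open>p > 1\<close>,
  this bounds \<open>k\<close>.
\<close>

lemma weakly_null_unit_sequence:
  assumes p: "1 < p"
  shows "weakly_null p unit_sequence"
  unfolding weakly_null_def
proof (intro allI impI)
  fix \<phi> assume \<phi>: "bounded_functional p \<phi>"
  obtain C where C: "\<And>x. x \<in> ell p \<Longrightarrow> norm (\<phi> x) \<le> C * ell_norm p x"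
    using \<phi> unfolding bounded_functional_def by blast
  show "(\<lambda>n. \<phi> (unit_sequence n)) \<longlonglongrightarrow> 0"
  proof (rule LIMSEQ_I)
    fix \<epsilon> :: real assume \<epsilon>: "0 < \<epsilon>"
    define B where "B = {n. \<epsilon> \<le> norm (\<phi> (unit_sequence n))}"
    have bound: "real (card A) * \<epsilon> \<le> C * real (card A) powr (1 / p)"
      if A: "finite A" "A \<subseteq> B" for A
    proof -
      \<comment> \<open>Unimodular coefficients that rotate all the values of \<open>\<phi>\<close> onto the positive real axis.\<close>
      define x where "x = (\<lambda>j. cnj (sgn (\<phi> (unit_sequence j))))"
      have nz: "\<phi> (unit_sequence j) \<noteq> 0" if "j \<in> A" for j
        using A that \<epsilon> by (auto simp: B_def)
      have eq: "x j * \<phi> (unit_sequence j) = of_real (norm (\<phi> (unit_sequence j)))" for j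
        by (cases "\<phi> (unit_sequence j) = 0")
           (auto simp: x_def sgn_eq power2_eq_square mult.commute
             complex_norm_square[symmetric])
      have "real (card A) * \<epsilon> \<le> (\<Sum>j\<in>A. norm (\<phi> (unit_sequence j)))"
        using A sum_bounded_below[of A \<epsilon> "\<lambda>j. norm (\<phi> (unit_sequence j))"] by (auto simp: B_def)
      also have "\<dots> = norm (\<phi> (restrict_to A x))"
        unfolding bounded_functional_finite_support[OF p \<phi> A(1)] eq of_real_sum[symmetric] norm_of_real
        by (simp add: sum_nonneg)
      also have "\<dots> \<le> C * ell_norm p (restrict_to A x)"
        by (intro C finite_support_ell A)
      also have "ell_norm p (restrict_to A x) = real (card A) powr (1 / p)"
        using nz unfolding ell_norm_finite_support[OF A(1)]
        by (simp add: x_def norm_sgn)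
      finally show ?thesis .
    qed
    have "finite B"
    proof (rule ccontr)
      assume inf: "infinite B"
      have "(\<lambda>k. real k powr (1 / p - 1)) \<longlonglongrightarrow> 0"
        using p by (intro tendsto_neg_powr filterlim_real_sequentially) (auto simp: field_simps)
      then have "(\<lambda>k. C * real k powr (1 / p - 1)) \<longlonglongrightarrow> 0"
        by (rule tendsto_mult_right_zero)
      then obtain k0 where k0: "\<And>k. k \<ge> k0 \<Longrightarrow> C * real k powr (1 / p - 1) < \<epsilon>"
        using LIMSEQ_D[of _ 0 \<epsilon>] \<epsilon> by fastforce
      obtain A where A: "finite A" "card A = Suc k0" "A \<subseteq> B"
        using infinite_arbitrarily_large[OF inf, of "Suc k0"] by blast
      have "real (Suc k0) * \<epsilon> \<le> C * real (Suc k0) powr (1 / p)"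
        using bound[OF A(1,3)] A(2) by simp
      also have "real (Suc k0) powr (1 / p) = real (Suc k0) * real (Suc k0) powr (1 / p - 1)"
        using powr_add[of "real (Suc k0)" 1 "1 / p - 1"] by simp
      finally have "\<epsilon> \<le> C * real (Suc k0) powr (1 / p - 1)"
        by (simp add: mult.left_commute[of C] del: of_nat_Suc)
      then show False
        using k0[of "Suc k0"] by simp
    qed
    then obtain m where m: "\<And>n. n \<in> B \<Longrightarrow> n \<le> m"
      using finite_nat_set_iff_bounded_le[of B] by auto
    have "norm (\<phi> (unit_sequence n) - 0) < \<epsilon>" if "n \<ge> Suc m" for n
      using m[of n] that by (force simp: B_def)
    then show "\<exists>m. \<forall>n\<ge>m. norm (\<phi> (unit_sequence n) - 0) < \<epsilon>"
      by (intro exI[of _ "Suc m"] allI impI)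
  qed
qed

section \<open>The form of an operator\<close>

lemma bounded_operator_bound:
  assumes "bounded_operator p T"
  obtains C where "0 \<le> C" "\<And>x. x \<in> ell p \<Longrightarrow> ell_norm p (T x) \<le> C * ell_norm p x"
proof -
  obtain C where C: "\<And>x. x \<in> ell p \<Longrightarrow> ell_norm p (T x) \<le> C * ell_norm p x"
    using assms unfolding bounded_operator_def by blast
  have "ell_norm p (T x) \<le> max C 0 * ell_norm p x" if "x \<in> ell p" for x
    using C[OF that] mult_right_mono[of C "max C 0" "ell_norm p x"] ell_norm_nonneg[of p x]
    by linarith
  then show ?thesis
    using that[of "max C 0"] by simp
qed

abbreviation form ::
    "real \<Rightarrow> ((nat \<Rightarrow> complex) \<Rightarrow> nat \<Rightarrow> complex) \<Rightarrow> (nat \<Rightarrow> complex) \<Rightarrow> (nat \<Rightarrow> complex) \<Rightarrow> complex"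
  where "form p T x y \<equiv> pairing (T x) (duality_map p y)"

context
  fixes p :: real and T :: "(nat \<Rightarrow> complex) \<Rightarrow> nat \<Rightarrow> complex"
  assumes p: "1 < p" and T: "bounded_operator p T"
begin

lemma operator_maps_ell: "x \<in> ell p \<Longrightarrow> T x \<in> ell p"
  using T by (simp add: bounded_operator_def)

lemma form_add_left:
  assumes "x \<in> ell p" "x' \<in> ell p" "y \<in> ell p"
  shows "form p T (\<lambda>j. x j + x' j) y = form p T x y + form p T x' y"
  using T assms pairing_add_left[OF p operator_maps_ell operator_maps_ell] by (simp add: bounded_operator_def)

lemma form_scale_left:
  assumes "x \<in> ell p" "y \<in> ell p"
  shows "form p T (\<lambda>j. a * x j) y = a * form p T x y"
proof -
  have "T (\<lambda>j. a * x j) = (\<lambda>j. a * T x j)"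
    using T[unfolded bounded_operator_def, THEN conjunct2, THEN conjunct2, THEN conjunct1] assms(1)
    by simp
  then show ?thesis
    using pairing_scale_left[OF p operator_maps_ell[OF assms(1)] assms(2)] by simp
qed

lemma form_bound:
  "\<exists>C\<ge>0. \<forall>x\<in>ell p. \<forall>y\<in>ell p.
    norm (form p T x y) \<le> C * ell_norm p x * ell_norm p y powr (p - 1)"
proof -
  obtain C where C: "0 \<le> C" "\<And>x. x \<in> ell p \<Longrightarrow> ell_norm p (T x) \<le> C * ell_norm p x"
    using bounded_operator_bound[OF T] by blast
  have "norm (form p T x y) \<le> (2 * C) * ell_norm p x * ell_norm p y powr (p - 1)"
    if "x \<in> ell p" "y \<in> ell p" for x y
  proof -
    have "norm (form p T x y) \<le> 2 * ell_norm p (T x) * ell_norm p y powr (p - 1)"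
      using that by (intro norm_pairing_le p operator_maps_ell)
    also have "\<dots> \<le> 2 * (C * ell_norm p x) * ell_norm p y powr (p - 1)"
      using that by (intro mult_right_mono mult_left_mono C) auto
    finally show ?thesis by (simp add: mult_ac)
  qed
  then show ?thesis
    using C(1) by (intro exI[of _ "2 * C"] conjI ballI) simp_all
qed

lemma bounded_functional_form:
  assumes "x \<in> ell p"
  shows "bounded_functional p (\<lambda>y. form p T y x)"
proof -
  obtain C where C: "0 \<le> C" "\<And>x y. x \<in> ell p \<Longrightarrow> y \<in> ell p \<Longrightarrow>
      norm (form p T x y) \<le> C * ell_norm p x * ell_norm p y powr (p - 1)"
    using form_bound by auto
  have bound: "norm (form p T y x) \<le> (C * ell_norm p x powr (p - 1)) * ell_norm p y" if "y \<in> ell p" for y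
    using C(2)[OF that assms] by (simp add: mult_ac)
  show ?thesis
    unfolding bounded_functional_def
  proof (intro conjI allI ballI)
    show "\<exists>C. \<forall>y\<in>ell p. norm (form p T y x) \<le> C * ell_norm p y"
      by (intro exI[of _ "C * ell_norm p x powr (p - 1)"] ballI bound)
  qed (simp_all only: form_add_left form_scale_left assms)
qed

lemma form_add_disjoint:
  assumes x: "x \<in> ell p" and y: "y \<in> ell p" and dis: "\<And>j. x j = 0 \<or> y j = 0"
  shows "form p T (\<lambda>j. x j + y j) (\<lambda>j. x j + y j) =
    form p T x x + form p T y x + (form p T x y + form p T y y)"
  by (simp only: pairing_add_right_disjoint[OF p operator_maps_ell[OF ell_add[OF p x y]] x y dis]
      form_add_left[OF x y x] form_add_left[OF x y y])

lemma form_scale: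
  assumes x: "x \<in> ell p" and a: "0 \<le> a"
  shows "form p T (\<lambda>j. of_real a * x j) (\<lambda>j. of_real a * x j) = of_real (a powr p) * form p T x x"
proof -
  have "a * a powr (p - 1) = a powr p"
    using a p powr_add[of a 1 "p - 1"] by (cases "a = 0") auto
  then have "complex_of_real a * of_real (a powr (p - 1)) = of_real (a powr p)"
    by (simp only: of_real_mult[symmetric])
  then show ?thesis
    by (simp only: form_scale_left[OF x ell_scale[OF x]]
        pairing_scale_right[OF p operator_maps_ell[OF x] x a] mult.assoc[symmetric])
qed

text \<open>
  Lets vectors that are not normalized, such as truncations, produce points of the numerical
  range.
\<close>

lemma form_normalized_in_numerical_range:
  assumes x: "x \<in> ell p" and nz: "ell_norm p x \<noteq> 0"
  shows "form p T x x / of_real (ell_norm p x powr p) \<in> numerical_range p T"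
proof -
  define a where "a = 1 / ell_norm p x"
  have a: "0 \<le> a" "a * ell_norm p x = 1"
    using nz ell_norm_nonneg[of p x] by (auto simp: a_def)
  let ?y = "\<lambda>j. of_real a * x j"
  have "?y \<in> ell p" "ell_norm p ?y = 1"
    using ell_scale[OF x] ell_norm_scale[OF p x, of "of_real a"] a by auto
  then have "form p T ?y ?y \<in> numerical_range p T"
    unfolding numerical_range_def by blast
  moreover have "form p T ?y ?y = form p T x x / of_real (ell_norm p x powr p)"
    using form_scale[OF x a(1)] ell_norm_nonneg[of p x] by (simp add: a_def powr_divide)
  ultimately show ?thesis by simp
qed

text \<open>
  With \<open>x = v + u\<close> split along \<open>A\<close> and its complement,
  \<open>w x - w u = \<langle>T v, J u\<rangle> + \<langle>T x, J v\<rangle>\<close>, and both terms are controlled by the norm of \<open>v\<close>. This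
  replaces a general continuity theorem for \<open>J\<close>. Letting both the vector and the index set vary
  with \<open>n\<close> covers the truncation of \<open>x\<close> as well as that of the weakly null sequence.
\<close>

lemma form_diff_restrict_to_tendsto_0:
  assumes x: "\<And>n. xs n \<in> ell p" and le: "\<And>n. ell_norm p (xs n) \<le> 1"
    and null: "(\<lambda>n. ell_norm p (restrict_to (A n) (xs n))) \<longlonglongrightarrow> 0"
  shows "(\<lambda>n. form p T (xs n) (xs n) -
    form p T (restrict_to (- A n) (xs n)) (restrict_to (- A n) (xs n))) \<longlonglongrightarrow> 0"
proof -
  obtain C where C: "0 \<le> C" "\<And>x y. x \<in> ell p \<Longrightarrow> y \<in> ell p \<Longrightarrow>
      norm (form p T x y) \<le> C * ell_norm p x * ell_norm p y powr (p - 1)"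
    using form_bound by auto
  let ?v = "\<lambda>n. restrict_to (A n) (xs n)" and ?u = "\<lambda>n. restrict_to (- A n) (xs n)"
  let ?e = "\<lambda>n. C * ell_norm p (?v n) + C * ell_norm p (?v n) powr (p - 1)"
  have uv: "?u n \<in> ell p" "?v n \<in> ell p" for n
    by (simp_all add: restrict_to_ell x)
  have "(\<lambda>n. ell_norm p (?v n) powr (p - 1)) \<longlonglongrightarrow> 0"
    using p by (intro tendsto_0_powr null) (auto simp: ell_norm_nonneg)
  then have e_lim: "?e \<longlonglongrightarrow> 0"
    using null by (intro tendsto_add_zero tendsto_mult_right_zero)
  have bound: "norm (form p T (xs n) (xs n) - form p T (?u n) (?u n)) \<le> ?e n" for n
  proof -
    have "form p T (xs n) (\<lambda>j. ?v n j + ?u n j) = form p T (xs n) (?v n) + form p T (xs n) (?u n)"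
      by (intro pairing_add_right_disjoint p operator_maps_ell x uv restrict_to_disjoint)
    moreover have "form p T (\<lambda>j. ?v n j + ?u n j) (?u n) = form p T (?v n) (?u n) + form p T (?u n) (?u n)"
      by (intro form_add_left uv)
    ultimately have split: "form p T (xs n) (xs n) - form p T (?u n) (?u n) =
        form p T (?v n) (?u n) + form p T (xs n) (?v n)"
      by (simp add: restrict_to_add_Compl)
    have "ell_norm p (?u n) \<le> 1"
      using le[of n] ell_norm_restrict_to_le[OF p x, of "- A n" n] by linarith
    then have "ell_norm p (?u n) powr (p - 1) \<le> 1"
      using p by (intro powr_le1) (auto simp: ell_norm_nonneg)
    then have "C * ell_norm p (?v n) * ell_norm p (?u n) powr (p - 1) \<le> C * ell_norm p (?v n)"
      using C(1) ell_norm_nonneg by (intro mult_left_le mult_nonneg_nonneg)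
    then have "norm (form p T (?v n) (?u n)) \<le> C * ell_norm p (?v n)"
      using C(2)[OF uv(2,1), of n n] by linarith
    moreover have "C * ell_norm p (xs n) * ell_norm p (?v n) powr (p - 1) \<le>
        C * ell_norm p (?v n) powr (p - 1)"
      using mult_left_le[OF le[of n] C(1)] by (intro mult_right_mono powr_ge_zero)
    then have "norm (form p T (xs n) (?v n)) \<le> C * ell_norm p (?v n) powr (p - 1)"
      using C(2)[OF x uv(2), of n n] by linarith
    ultimately show ?thesis
      unfolding split using norm_triangle_ineq[of "form p T (?v n) (?u n)" "form p T (xs n) (?v n)"]
      by linarith
  qed
  show ?thesis
    by (rule Lim_null_comparison[OF _ e_lim]) (intro always_eventually allI bound)
qed

text \<open>
  The value is the limit of \<open>w z\<^sub>n / \<parallel>z\<^sub>n\<parallel>\<^sup>p\<close> for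
  \<open>z\<^sub>n = t powr (1 / p) x + (1 - t) powr (1 / p) y\<^sub>n\<close>: both mixed terms vanish asymptotically, one by weak convergence of \<open>y\<^sub>n\<close> and the other by
  convergence of its coordinates. The norm of \<open>x\<close> appears in the denominator because \<open>x\<close>
  stands for a truncation of a unit vector.
\<close>

lemma combination_in_closure_numerical_range:
  assumes x: "x \<in> ell p" and y: "\<And>n. ys n \<in> ell p" and dis: "\<And>n j. x j = 0 \<or> ys n j = 0"
    and null: "weakly_null p ys" and le: "\<And>n. ell_norm p (ys n) \<le> 1"
    and lim_norm: "(\<lambda>n. ell_norm p (ys n) powr p) \<longlonglongrightarrow> 1"
    and lim: "(\<lambda>n. form p T (ys n) (ys n)) \<longlonglongrightarrow> l"
    and t: "0 \<le> t" "t \<le> 1" and nz: "t * ell_norm p x powr p + (1 - t) \<noteq> 0"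
  shows "(of_real t * form p T x x + of_real (1 - t) * l) /
    of_real (t * ell_norm p x powr p + (1 - t)) \<in> closure (numerical_range p T)"
proof -
  define a b where "a = t powr (1 / p)" and "b = (1 - t) powr (1 / p)"
  have ab: "0 \<le> a" "0 \<le> b" "a powr p = t" "b powr p = 1 - t"
    using t p by (auto simp: a_def b_def powr_powr)
  define u v where "u = (\<lambda>j. of_real a * x j)" and "v = (\<lambda>n j. of_real b * ys n j)"
  have uv: "u \<in> ell p" "v n \<in> ell p" "u j = 0 \<or> v n j = 0" for n j
    using ell_scale[OF x] ell_scale[OF y] dis[of j n] by (auto simp: u_def v_def)
  define z where "z = (\<lambda>n j. u j + v n j)"
  have z: "z n \<in> ell p" for n
    unfolding z_def by (intro ell_add p uv)
  have z_norm: "ell_norm p (z n) powr p = t * ell_norm p x powr p + (1 - t) * ell_norm p (ys n) powr p" for n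
  proof -
    have "ell_norm p (z n) powr p = ell_norm p u powr p + ell_norm p (v n) powr p"
      unfolding z_def by (intro ell_norm_powr_add_disjoint p uv)
    then show ?thesis
      using ab ell_norm_nonneg
      by (simp add: u_def v_def ell_norm_scale[OF p x] ell_norm_scale[OF p y] powr_mult)
  qed
  have z_norm_lim: "(\<lambda>n. ell_norm p (z n) powr p) \<longlonglongrightarrow> t * ell_norm p x powr p + (1 - t)"
    unfolding z_norm using tendsto_add[OF tendsto_const tendsto_mult[OF tendsto_const lim_norm]]
    by fastforce
  have form_z: "form p T (z n) (z n) = of_real t * form p T x x +
      of_real b * form p T (ys n) u +
      (of_real (b powr (p - 1)) * form p T u (ys n) + of_real (1 - t) * form p T (ys n) (ys n))" for n
  proof -
    have "form p T (z n) (z n) = form p T u u + form p T (v n) u + (form p T u (v n) + form p T (v n) (v n))"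
      unfolding z_def by (intro form_add_disjoint uv)
    moreover have "form p T u u = of_real t * form p T x x"
      unfolding u_def form_scale[OF x ab(1)] ab(3) ..
    moreover have "form p T (v n) (v n) = of_real (1 - t) * form p T (ys n) (ys n)"
      unfolding v_def form_scale[OF y ab(2)] ab(4) ..
    moreover have "form p T (v n) u = of_real b * form p T (ys n) u"
      unfolding v_def by (intro form_scale_left y uv)
    moreover have "form p T u (v n) = of_real (b powr (p - 1)) * form p T u (ys n)"
      unfolding v_def by (intro pairing_scale_right p operator_maps_ell y uv ab)
    ultimately show ?thesis
      by (simp only:)
  qed
  have "(\<lambda>n. form p T (ys n) u) \<longlonglongrightarrow> 0"
    using null bounded_functional_form[OF uv(1)] unfolding weakly_null_def by blast
  moreover have "(\<lambda>n. form p T u (ys n)) \<longlonglongrightarrow> 0"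
    by (intro pairing_tendsto_0 p operator_maps_ell uv(1) y le weakly_null_coordinate[OF p null])
  ultimately have "(\<lambda>n. form p T (z n) (z n)) \<longlonglongrightarrow>
      of_real t * form p T x x + of_real b * 0 + (of_real (b powr (p - 1)) * 0 + of_real (1 - t) * l)"
    unfolding form_z by (intro tendsto_intros lim)
  then have "(\<lambda>n. form p T (z n) (z n)) \<longlonglongrightarrow> of_real t * form p T x x + of_real (1 - t) * l"
    by simp
  then have quot: "(\<lambda>n. form p T (z n) (z n) / of_real (ell_norm p (z n) powr p)) \<longlonglongrightarrow>
      (of_real t * form p T x x + of_real (1 - t) * l) / of_real (t * ell_norm p x powr p + (1 - t))"
    using nz unfolding of_real_eq_0_iff[symmetric, where 'a = complex]
    by (intro tendsto_divide tendsto_of_real z_norm_lim)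
  have "\<forall>\<^sub>F n in sequentially. ell_norm p (z n) powr p \<noteq> 0"
    using tendsto_imp_eventually_ne[OF z_norm_lim nz] .
  then have "\<forall>\<^sub>F n in sequentially. form p T (z n) (z n) / of_real (ell_norm p (z n) powr p)
      \<in> closure (numerical_range p T)"
    by eventually_elim
      (intro subsetD[OF closure_subset] form_normalized_in_numerical_range z, auto)
  then show ?thesis
    using quot by (intro Lim_in_closed_set[OF closed_closure]) auto
qed

text \<open>
  Both vectors are truncated at the same \<open>N\<close>, so that their supports become disjoint. The first limit
  (\<open>n\<close> to infinity) is the preceding lemma; here \<open>N\<close> tends to infinity.
\<close>

lemma segment_in_closure_numerical_range:
  assumes l: "l \<in> essential_numerical_range p T" and z: "z \<in> numerical_range p T"
    and t: "0 \<le> t" "t \<le> 1"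
  shows "of_real t * z + of_real (1 - t) * l \<in> closure (numerical_range p T)"
proof -
  obtain x where x: "x \<in> ell p" "ell_norm p x = 1" "z = form p T x x"
    using z unfolding numerical_range_def by blast
  obtain ys where ys: "\<And>n. ys n \<in> ell p" "\<And>n. ell_norm p (ys n) = 1" "weakly_null p ys"
      "(\<lambda>n. form p T (ys n) (ys n)) \<longlonglongrightarrow> l"
    using l unfolding essential_numerical_range_def by blast
  let ?x = "\<lambda>N. restrict_to {..<N} x"
  let ?d = "\<lambda>N. t * ell_norm p (?x N) powr p + (1 - t)"
  have closure: "(of_real t * form p T (?x N) (?x N) + of_real (1 - t) * l) / of_real (?d N)
      \<in> closure (numerical_range p T)" if nz: "?d N \<noteq> 0" for N
  proof -
    let ?P = "\<lambda>n. restrict_to {..<N} (ys n)" and ?Q = "\<lambda>n. restrict_to (- {..<N}) (ys n)"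
    have P0: "(\<lambda>n. ell_norm p (?P n)) \<longlonglongrightarrow> 0"
      by (intro ell_norm_initial_tendsto_0 p ys(1) weakly_null_coordinate[OF p ys(3)])
    have "(\<lambda>n. 1 - ell_norm p (?P n) powr p) \<longlonglongrightarrow> 1 - 0"
      using p by (intro tendsto_diff tendsto_const tendsto_0_powr P0) (auto simp: ell_norm_nonneg)
    moreover have "ell_norm p (?Q n) powr p = 1 - ell_norm p (?P n) powr p" for n
      using ell_norm_powr_restrict_to_Compl[OF p ys(1), of n "{..<N}"] ys(2)[of n] by simp
    ultimately have "(\<lambda>n. ell_norm p (?Q n) powr p) \<longlonglongrightarrow> 1"
      by simp
    moreover have "(\<lambda>n. form p T (?Q n) (?Q n)) \<longlonglongrightarrow> l"
      using tendsto_diff[OF ys(4) form_diff_restrict_to_tendsto_0[OF ys(1) _ P0]] ys(2) by simp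
    moreover have "ell_norm p (?Q n) \<le> 1" for n
      using ell_norm_restrict_to_le[OF p ys(1), of "- {..<N}" n] ys(2)[of n] by simp
    ultimately show ?thesis
      using nz by (intro combination_in_closure_numerical_range[where ys = ?Q] t restrict_to_ell x
          ys weakly_null_tail p) (auto simp: restrict_to_def)
  qed
  have tail: "(\<lambda>N. ell_norm p (restrict_to (- {..<N}) x)) \<longlonglongrightarrow> 0"
    by (rule ell_norm_tail_tendsto_0[OF p x(1)])
  have "ell_norm p (?x N) powr p = 1 - ell_norm p (restrict_to (- {..<N}) x) powr p" for N
    using ell_norm_powr_restrict_to_Compl[OF p x(1), of "{..<N}"] x(2) by simp
  moreover have "(\<lambda>N. 1 - ell_norm p (restrict_to (- {..<N}) x) powr p) \<longlonglongrightarrow> 1 - 0"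
    using p by (intro tendsto_diff tendsto_const tendsto_0_powr tail) (auto simp: ell_norm_nonneg)
  ultimately have "(\<lambda>N. ell_norm p (?x N) powr p) \<longlonglongrightarrow> 1"
    by simp
  then have "?d \<longlonglongrightarrow> t * 1 + (1 - t)"
    by (intro tendsto_intros)
  then have d: "?d \<longlonglongrightarrow> 1"
    by simp
  have "(\<lambda>N. form p T x x - form p T (?x N) (?x N)) \<longlonglongrightarrow> 0"
    using form_diff_restrict_to_tendsto_0[of "\<lambda>_. x" "\<lambda>N. - {..<N}"] x tail by simp
  then have "(\<lambda>N. form p T (?x N) (?x N)) \<longlonglongrightarrow> z"
    using tendsto_diff[OF tendsto_const[of z]] x(3) by fastforce
  then have "(\<lambda>N. (of_real t * form p T (?x N) (?x N) + of_real (1 - t) * l) / of_real (?d N))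
      \<longlonglongrightarrow> (of_real t * z + of_real (1 - t) * l) / of_real 1"
    by (intro tendsto_intros d) auto
  moreover have "\<forall>\<^sub>F N in sequentially.
      (of_real t * form p T (?x N) (?x N) + of_real (1 - t) * l) / of_real (?d N)
      \<in> closure (numerical_range p T)"
    using tendsto_imp_eventually_ne[OF d one_neq_zero] by eventually_elim (rule closure)
  ultimately show ?thesis
    using Lim_in_closed_set[OF closed_closure] by fastforce
qed

lemma essential_numerical_range_subset_closure:
  "essential_numerical_range p T \<subseteq> closure (numerical_range p T)"
proof
  fix l assume "l \<in> essential_numerical_range p T"
  then obtain xs where xs: "\<And>n. xs n \<in> ell p" "\<And>n. ell_norm p (xs n) = 1"
      "(\<lambda>n. form p T (xs n) (xs n)) \<longlonglongrightarrow> l"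
    unfolding essential_numerical_range_def by auto
  then have "form p T (xs n) (xs n) \<in> numerical_range p T" for n
    unfolding numerical_range_def by blast
  then show "l \<in> closure (numerical_range p T)"
    using xs(3) unfolding closure_sequential by (intro exI[of _ "\<lambda>n. form p T (xs n) (xs n)"]) auto
qed

lemma star_centre_of_essential_numerical_range:
  assumes l: "l \<in> essential_numerical_range p T"
  shows "star_centre (closure (numerical_range p T)) l"
  unfolding star_centre_def
proof (intro conjI ballI)
  show "l \<in> closure (numerical_range p T)"
    using l essential_numerical_range_subset_closure by blast
next
  fix z and t :: real assume z: "z \<in> closure (numerical_range p T)" and t: "t \<in> {0..1}"
  let ?f = "\<lambda>z. (1 - t) *\<^sub>R l + t *\<^sub>R z"
  \<comment> \<open>The affine map \<open>?f\<close> is continuous, so it is enough to treat \<open>z\<close> in the numerical range itself.\<close>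
  have "?f ` closure (numerical_range p T) \<subseteq> closure (numerical_range p T)"
  proof (rule image_closure_subset)
    show "continuous_on (closure (numerical_range p T)) ?f"
      by (intro continuous_intros)
    show "?f ` numerical_range p T \<subseteq> closure (numerical_range p T)"
      using segment_in_closure_numerical_range[OF l] t
      by (auto simp: scaleR_conv_of_real add.commute)
  qed simp
  then show "?f z \<in> closure (numerical_range p T)"
    using z by blast
qed

text \<open>
  The values on the unit vectors form a bounded sequence of complex numbers, and weak convergence to 0
  passes to subsequences.
\<close>

lemma essential_numerical_range_nonempty: "essential_numerical_range p T \<noteq> {}"
proof -
  have e: "unit_sequence n \<in> ell p" "ell_norm p (unit_sequence n) = 1" for n
    by (simp_all add: unit_sequence_def finite_support_ell ell_norm_finite_support)
  obtain C where C: "0 \<le> C" "\<And>x y. x \<in> ell p \<Longrightarrow> y \<in> ell p \<Longrightarrow>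
      norm (form p T x y) \<le> C * ell_norm p x * ell_norm p y powr (p - 1)"
    using form_bound by auto
  have "norm (form p T (unit_sequence n) (unit_sequence n)) \<le> C" for n
    using C(2)[OF e(1) e(1), of n n] e(2)[of n] by simp
  then have "bounded (range (\<lambda>n. form p T (unit_sequence n) (unit_sequence n)))"
    unfolding bounded_iff by blast
  then obtain l r where r: "strict_mono r"
      "((\<lambda>n. form p T (unit_sequence n) (unit_sequence n)) \<circ> r) \<longlonglongrightarrow> l"
    using bounded_imp_convergent_subsequence by blast
  have "(\<lambda>n. \<phi> (unit_sequence (r n))) \<longlonglongrightarrow> 0" if "bounded_functional p \<phi>" for \<phi>
    using LIMSEQ_subseq_LIMSEQ[OF _ r(1), of "\<lambda>n. \<phi> (unit_sequence n)"] that
      weakly_null_unit_sequence[OF p] by (auto simp: weakly_null_def o_def)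
  then have "weakly_null p (\<lambda>n. unit_sequence (r n))"
    by (simp add: weakly_null_def)
  then have "l \<in> essential_numerical_range p T"
    unfolding essential_numerical_range_def using e r(2)
    by (auto intro!: exI[of _ "\<lambda>n. unit_sequence (r n)"] simp: o_def)
  then show ?thesis by blast
qed

end

theorem theorem3p18:
  fixes p :: real and T :: "(nat \<Rightarrow> complex) \<Rightarrow> nat \<Rightarrow> complex"
  assumes "1 < p" and "bounded_operator p T"
  shows "starlike (closure (numerical_range p T)) \<and>
    (\<forall>c\<in>essential_numerical_range p T. star_centre (closure (numerical_range p T)) c)"
  using star_centre_of_essential_numerical_range[OF assms]
    essential_numerical_range_nonempty[OF assms]
  by (auto simp: starlike_iff_star_centre)

end
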